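(* Let $f:\mathbb R\to\mathbb R$ be an even (measurable) function for which there exist fixed $\epsilon>0$ and $A>0$ with $|f(x)|<A(1+|x|)^{-(1+\epsilon)}$ for all $x\in\mathbb R$. Then for every positive integer $N$, $$\mathbb E\{Z_f\}=\widehat f(0).$$
   Context: The Fourier transform is $\widehat f(u)=\int_{-\infty}^\infty f(x)e^{-2\pi i xu}\,dx$. For a positive integer $N$ define the $2\pi$-periodic function $$F_N(\theta)=\sum_{j=-\infty}^\infty f\left(\tfrac N{2\pi}(\theta+2\pi j)\right),$$ and for an $N\times N$ unitary matrix $U$ with eigenvalues $e^{i\theta_1},\dots,e^{i\theta_N}$ (with multiplicity) define $Z_f(U)=\sum_{j=1}^N F_N(\theta_j)$. $\mathbb E$ denotes expectation over $U$ in the unitary group $U(N)$ with respect to Haar probability measure. *)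

theory Defs
  imports "HOL-Probability.Probability"
begin

definition fourier_transform :: "(real \<Rightarrow> real) \<Rightarrow> real \<Rightarrow> complex" where
  "fourier_transform f u =
     (LINT x|lebesgue. complex_of_real (f x) * exp (- 2 * of_real pi * \<i> * of_real (x * u)))"

definition periodized :: "(real \<Rightarrow> real) \<Rightarrow> nat \<Rightarrow> real \<Rightarrow> real" where
  "periodized f N \<theta> =
     (\<Sum>\<^sub>\<infinity>j::int. f (real N / (2 * pi) * (\<theta> + 2 * pi * of_int j)))"

definition conj_transpose :: "complex^'n^'m \<Rightarrow> complex^'m^'n" where
  "conj_transpose A = (\<chi> i j. cnj (A $ j $ i))"

definition unitary_group :: "(complex^'n^'n) set" where
  "unitary_group = {U. conj_transpose U ** U = mat 1 \<and> U ** conj_transpose U = mat 1}"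

definition char_poly :: "complex^'n^'n \<Rightarrow> complex poly" where
  "char_poly A = det (\<chi> i j. if i = j then [:- (A $ i $ j), 1:] else [:- (A $ i $ j):])"

definition eigenvalues :: "complex^'n^'n \<Rightarrow> complex multiset" where
  "eigenvalues A = proots (char_poly A)"

text \<open>The linear statistic \<open>Z\<^sub>f\<close>. The eigenangles are taken in \<open>(-\<pi>, \<pi>]\<close>; by
  periodicity any other choice gives the same value, see \<open>linear_statistic_eigenangles\<close>.\<close>

definition linear_statistic :: "(real \<Rightarrow> real) \<Rightarrow> complex^'n^'n \<Rightarrow> real" where
  "linear_statistic f U = (\<Sum>z\<in>#eigenvalues U. periodized f CARD('n) (Arg z))"

text \<open>The Haar probability measure, characterized as the left-invariant probability measure
  on the Borel sets of the unitary group. It exists and is unique because the group is compact.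
  For a merely Lebesgue measurable \<open>f\<close> the statistic \<open>Z\<^sub>f\<close> is measurable only with respect to
  the completion of this measure, so expectations are to be taken over that completion.\<close>

definition haar_prob_unitary :: "(complex^'n^'n) measure \<Rightarrow> bool" where
  "haar_prob_unitary M \<longleftrightarrow>
     prob_space M \<and>
     sets M = sets (restrict_space borel unitary_group) \<and>
     (\<forall>V\<in>unitary_group. distr M M (\<lambda>U. V ** U) = M)"

lemma periodized_add_multiple:
  assumes "N > 0"
  shows "periodized f N (\<theta> + 2 * pi * of_int k) = periodized f N \<theta>"
proof -
  have "(\<Sum>\<^sub>\<infinity>j::int. f (real N / (2 * pi) * (\<theta> + 2 * pi * of_int (j + k)))) =
        (\<Sum>\<^sub>\<infinity>j::int. f (real N / (2 * pi) * (\<theta> + 2 * pi * of_int j)))"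
    by (rule infsum_reindex_bij_betw[where g = "\<lambda>j. j + k"
          and f = "\<lambda>j. f (real N / (2 * pi) * (\<theta> + 2 * pi * of_int j))"])
       (rule bij_betwI[where g = "\<lambda>j. j - k"], auto)
  then show ?thesis
    by (simp add: periodized_def algebra_simps)
qed

lemma periodized_Arg_cis:
  assumes "N > 0"
  shows "periodized f N (Arg (cis \<theta>)) = periodized f N \<theta>"
proof -
  have "cis (Arg (cis \<theta>)) = cis \<theta>"
    by (simp add: cis_Arg)
  then have "sin (Arg (cis \<theta>)) = sin \<theta> \<and> cos (Arg (cis \<theta>)) = cos \<theta>"
    by (simp add: complex_eq_iff)
  then obtain k :: int where "Arg (cis \<theta>) = \<theta> + 2 * pi * of_int k"
    unfolding sin_cos_eq_iff by auto
  then show ?thesis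
    using periodized_add_multiple[OF assms] by simp
qed

lemma linear_statistic_eigenangles:
  fixes U :: "complex^'n^'n"
  assumes "mset (map cis \<theta>s) = eigenvalues U"
  shows "linear_statistic f U = (\<Sum>\<theta>\<leftarrow>\<theta>s. periodized f CARD('n) \<theta>)"
proof -
  have "linear_statistic f U
      = sum_mset (image_mset (\<lambda>z. periodized f CARD('n) (Arg z)) (mset (map cis \<theta>s)))"
    by (simp only: linear_statistic_def assms)
  also have "\<dots> = (\<Sum>\<theta>\<leftarrow>\<theta>s. periodized f CARD('n) (Arg (cis \<theta>)))"
    by (simp flip: mset_map sum_mset_sum_list add: o_def)
  also have "\<dots> = (\<Sum>\<theta>\<leftarrow>\<theta>s. periodized f CARD('n) \<theta>)"
    by (simp add: periodized_Arg_cis)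
  finally show ?thesis .
qed

end

theory Submission
  imports Defs "HOL-Computational_Algebra.Fundamental_Theorem_Algebra"
begin

text \<open>Haar measure is invariant under \<open>U \<mapsto> e\<^sup>i\<^sup>t U\<close>, which rotates all eigenvalues by \<open>t\<close>.
  Averaging over \<open>t \<in> [0, 2\<pi>)\<close> and exchanging the integrals replaces each eigenvalue's
  contribution by the mean of \<open>F\<^sub>N\<close> over a period, which unfolds to the integral of \<open>f\<close> over
  the line divided by \<open>N\<close>. This is done for nonnegative Borel functions with values in
  \<open>[0, \<infinity>]\<close>; applied to the indicator of a null set it shows that almost surely no
  eigenangle orbit meets the set where a Lebesgue measurable \<open>f\<close> differs from a Borel version.\<close>

subsection \<open>Eigenvalues of unitary matrices\<close>

lemma poly_det: "poly (det P) w = det (\<chi> i j. poly (P $ i $ j) w)"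
  for P :: "'a::comm_ring_1 poly^'n^'n"
  by (simp add: det_def poly_sum poly_prod)

lemma poly_char_poly: "poly (char_poly A) w = det (mat w - A)"
  unfolding char_poly_def poly_det
  by (rule arg_cong[where f = det]) (simp add: vec_eq_iff mat_def)

text \<open>A permutation other than the identity moves some index, and the factor picked there is
  off the diagonal, hence constant. The other factors have degree at most 1, so the product falls
  short of the full degree.\<close>

lemma degree_prod_off_diagonal_less:
  fixes P :: "'a::comm_ring_1 poly^'n^'n"
  assumes "\<And>i j. degree (P $ i $ j) \<le> (if i = j then 1 else 0)" "p \<noteq> id"
  shows "degree (\<Prod>i\<in>UNIV. P $ i $ p i) < CARD('n)"
proof -
  obtain k where k: "p k \<noteq> k"
    using assms(2) by (auto simp: fun_eq_iff)
  have "degree (\<Prod>i\<in>UNIV. P $ i $ p i) \<le> (\<Sum>i\<in>UNIV. degree (P $ i $ p i))"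
    using degree_prod_sum_le[of UNIV "\<lambda>i. P $ i $ p i"] by (simp add: o_def)
  also have "\<dots> < (\<Sum>i\<in>(UNIV::'n set). 1)"
  proof (rule sum_strict_mono_ex1)
    show "\<forall>i\<in>UNIV. degree (P $ i $ p i) \<le> 1"
      using assms(1) by (metis (full_types) le_zero_eq nle_le order_trans zero_le)
    show "\<exists>i\<in>UNIV. degree (P $ i $ p i) < 1"
      using assms(1)[of k "p k"] k by (auto intro!: bexI[of _ k])
  qed simp
  finally show ?thesis by simp
qed

text \<open>In the Leibniz expansion only the identity permutation reaches the top degree, and its
  term is a product of monic linear factors.\<close>

lemma coeff_char_poly_card: "coeff (char_poly A) CARD('n) = 1" for A :: "complex^'n^'n"
proof -
  let ?P = "\<chi> i j. if i = j then [:- (A $ i $ j), 1:] else [:- (A $ i $ j):]"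
  let ?t = "\<lambda>p. \<Prod>i\<in>UNIV. ?P $ i $ p i"
  have "degree (\<Prod>i\<in>UNIV. [:- (A $ i $ i), 1:]) = CARD('n)"
    by (simp add: degree_prod_sum_eq)
  then have monic: "coeff (\<Prod>i\<in>UNIV. [:- (A $ i $ i), 1:]) CARD('n) = 1"
    using lead_coeff_prod[of "\<lambda>i. [:- (A $ i $ i), 1:]" UNIV] by simp
  have "coeff (of_int (sign p) * ?t p) CARD('n) = (if p = id then 1 else 0)" for p :: "'n \<Rightarrow> 'n"
  proof (cases "p = id")
    case True
    then show ?thesis using monic by simp
  next
    case False
    have "degree (of_int (sign p) * ?t p) < CARD('n)"
      using degree_prod_off_diagonal_less[of ?P p, OF _ False] by (auto simp: sign_def)
    then show ?thesis
      using False by (simp add: coeff_eq_0)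
  qed
  then show ?thesis
    by (simp add: char_poly_def det_def coeff_sum sum.delta permutes_id)
qed

lemma degree_char_poly: "degree (char_poly A) = CARD('n)" for A :: "complex^'n^'n"
proof (rule antisym)
  let ?P = "\<chi> i j. if i = j then [:- (A $ i $ j), 1:] else [:- (A $ i $ j):]"
  have "degree (of_int (sign p) * (\<Prod>i\<in>UNIV. ?P $ i $ p i)) \<le> CARD('n)" for p :: "'n \<Rightarrow> 'n"
  proof (cases "p = id")
    case True
    then show ?thesis by (simp add: degree_prod_sum_eq)
  next
    case False
    have "degree (?P $ i $ j) \<le> (if i = j then 1 else 0)" for i j
      by simp
    from degree_prod_off_diagonal_less[OF this False] show ?thesis
      by (simp add: sign_def less_imp_le)
  qed
  then show "degree (char_poly A) \<le> CARD('n)"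
    unfolding char_poly_def det_def by (intro degree_sum_le) auto
  show "CARD('n) \<le> degree (char_poly A)"
    by (rule le_degree) (simp add: coeff_char_poly_card)
qed

lemma size_eigenvalues: "size (eigenvalues A) = CARD('n)" for A :: "complex^'n^'n"
  by (simp add: eigenvalues_def size_proots_complex degree_char_poly)

lemma proots_prod_linear: "proots (\<Prod>z\<in>#S. [:- z, 1:]) = S" for S :: "'a::idom multiset"
proof (induction S)
  case (add z S)
  have "(\<Prod>z\<in>#S. [:- z, 1:]) \<noteq> 0"
    by (auto simp: prod_mset_zero_iff)
  with add show ?case
    by (simp add: proots_mult del: mult_pCons_left)
qed simp

lemma poly_prod_linear: "poly (\<Prod>z\<in>#S. [:- z, 1:]) w = (\<Prod>z\<in>#S. w - z)"
  for S :: "'a::comm_ring_1 multiset"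
  by (induction S) (auto simp: algebra_simps)

text \<open>By algebraic closedness the monic characteristic polynomial splits into linear factors,
  and \<open>proots\<close> of such a product returns the multiset of its roots with
  multiplicity.\<close>

lemma det_eq_prod_eigenvalues: "det (mat w - A) = (\<Prod>z\<in>#eigenvalues A. w - z)"
  for A :: "complex^'n^'n"
proof -
  have "char_poly A \<noteq> 0"
    using coeff_char_poly_card[of A] by auto
  then obtain S where "size S = degree (char_poly A)"
    and S: "char_poly A = smult (lead_coeff (char_poly A)) (\<Prod>z\<in>#S. [:- z, 1:])"
    using alg_closed_imp_factorization by blast
  then have *: "char_poly A = (\<Prod>z\<in>#S. [:- z, 1:])"
    by (simp add: degree_char_poly coeff_char_poly_card)
  then have "eigenvalues A = S"
    by (simp add: eigenvalues_def proots_prod_linear)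
  with * show ?thesis
    by (metis poly_char_poly poly_prod_linear)
qed

text \<open>A complex polynomial is determined by its values, so eigenvalues with multiplicity can
  be read off from a determinant identity in a scalar \<open>w\<close>, without handling polynomial
  matrices.\<close>

lemma eigenvalues_eqI:
  assumes "\<And>w. det (mat w - A) = (\<Prod>z\<in>#S. w - z)"
  shows "eigenvalues A = S"
proof -
  have "char_poly A = (\<Prod>z\<in>#S. [:- z, 1:])"
    using assms by (intro poly_eq_poly_eq_iff[THEN iffD1])
      (simp add: fun_eq_iff poly_char_poly poly_prod_linear)
  then show ?thesis
    by (simp add: eigenvalues_def proots_prod_linear)
qed

lemma det_mat_scale: "det (mat c ** A) = c ^ CARD('n) * det A" for A :: "'a::comm_ring_1^'n^'n"
proof -
  have "det (mat c :: 'a^'n^'n) = c ^ CARD('n)"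
    by (subst det_diagonal) (auto simp: mat_def)
  then show ?thesis by (simp add: det_mul)
qed

lemma mat_mult_nth: "(mat c ** A) $ i $ j = c * A $ i $ j" for A :: "'a::semiring_1^'n^'n"
  by (simp add: matrix_matrix_mult_def mat_def if_distrib[of "\<lambda>x. x * _"] sum.delta cong: if_cong)

text \<open>Pulling \<open>c\<close> out of every row of \<open>mat w - mat c ** A\<close> gives a
  factor \<open>c ^ CARD('n)\<close>. There are exactly \<open>CARD('n)\<close> eigenvalues, so each
  linear factor \<open>w / c - z\<close> absorbs one \<open>c\<close>.\<close>

lemma eigenvalues_mat_mult:
  fixes A :: "complex^'n^'n"
  assumes "c \<noteq> 0"
  shows "eigenvalues (mat c ** A) = image_mset (\<lambda>z. c * z) (eigenvalues A)"
proof (rule eigenvalues_eqI)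
  fix w
  have "mat w - mat c ** A = mat c ** (mat (w / c) - A)"
    using assms by (simp add: vec_eq_iff mat_mult_nth right_diff_distrib) (simp add: mat_def)
  then have "det (mat w - mat c ** A) = c ^ CARD('n) * (\<Prod>z\<in>#eigenvalues A. w / c - z)"
    by (simp add: det_mat_scale det_eq_prod_eigenvalues)
  also have "\<dots> = (\<Prod>z\<in>#eigenvalues A. c * (w / c - z))"
    by (simp add: prod_mset.distrib size_eigenvalues)
  also have "\<dots> = (\<Prod>z\<in>#image_mset (\<lambda>z. c * z) (eigenvalues A). w - z)"
    using assms by (simp add: right_diff_distrib multiset.map_comp o_def)
  finally show "det (mat w - mat c ** A) = \<dots>" .
qed

section \<open>Unitary matrices: unimodular eigenvalues, closure under products, compactness\<close>

lemma unitary_groupD: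
  assumes "U \<in> unitary_group"
  shows "conj_transpose U *v (U *v x) = x"
  using assms by (simp add: unitary_group_def matrix_vector_mul_assoc)

text \<open>Moving the adjoint across the Hermitian form turns \<open>U\<close> on both sides into
  \<open>conj_transpose U ** U\<close>, which is the identity.\<close>

lemma sum_norm_sq_unitary:
  assumes "U \<in> unitary_group"
  shows "(\<Sum>i\<in>UNIV. (norm ((U *v x) $ i))\<^sup>2) = (\<Sum>i\<in>UNIV. (norm (x $ i))\<^sup>2)"
proof -
  have conj: "(conj_transpose U *v y) $ k = (\<Sum>i\<in>UNIV. cnj (U $ i $ k) * y $ i)" for y k
    by (simp add: matrix_vector_mult_def conj_transpose_def)
  have "complex_of_real (\<Sum>i\<in>UNIV. (norm ((U *v x) $ i))\<^sup>2) = (\<Sum>i\<in>UNIV. cnj ((U *v x) $ i) * (U *v x) $ i)"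
    by (simp only: of_real_sum complex_norm_square mult.commute)
  also have "\<dots> = (\<Sum>i\<in>UNIV. \<Sum>k\<in>UNIV. cnj (x $ k) * (cnj (U $ i $ k) * (U *v x) $ i))"
    by (simp add: matrix_vector_mult_def[of U] sum_distrib_right sum_distrib_left mult_ac)
  also have "\<dots> = (\<Sum>k\<in>UNIV. cnj (x $ k) * (conj_transpose U *v (U *v x)) $ k)"
    by (subst sum.swap) (simp add: conj sum_distrib_left)
  also have "\<dots> = complex_of_real (\<Sum>i\<in>UNIV. (norm (x $ i))\<^sup>2)"
    by (simp only: unitary_groupD[OF assms] of_real_sum complex_norm_square mult.commute)
  finally show ?thesis by (simp only: of_real_eq_iff)
qed

text \<open>At a root of the characteristic polynomial the matrix \<open>mat z - U\<close> is
  singular and has a nonzero kernel vector \<open>x\<close>. Then \<open>U *v x = z *s x\<close>,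
  and preservation of the norm of \<open>x\<close> forces the modulus of \<open>z\<close> to be
  1.\<close>

lemma norm_eigenvalue_unitary:
  fixes U :: "complex^'n^'n"
  assumes "U \<in> unitary_group" "z \<in># eigenvalues U"
  shows "norm z = 1"
proof -
  have "det (mat z - U) = 0"
    using assms(2) by (auto simp: det_eq_prod_eigenvalues prod_mset_zero_iff)
  then obtain x where x: "x \<noteq> 0" "(mat z - U) *v x = 0"
    using matrix_left_invertible_ker[of "mat z - U"] invertible_det_nz[of "mat z - U"]
    by (auto simp: invertible_left_inverse)
  have "mat z *v x = z *s x"
    by (simp add: vec_eq_iff matrix_vector_mult_def mat_def if_distrib[of "\<lambda>x. x * _"] sum.delta cong: if_cong)
  then have Ux: "U *v x = z *s x"
    using x(2) by (simp add: matrix_vector_mult_diff_rdistrib)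
  have "(\<Sum>i\<in>UNIV. (norm (x $ i))\<^sup>2) = (norm z)\<^sup>2 * (\<Sum>i\<in>UNIV. (norm (x $ i))\<^sup>2)"
    using sum_norm_sq_unitary[OF assms(1), of x] by (simp add: Ux norm_mult power_mult_distrib sum_distrib_left)
  moreover have "(\<Sum>i\<in>UNIV. (norm (x $ i))\<^sup>2) \<noteq> 0"
    using x(1) by (auto simp: sum_nonneg_eq_0_iff vec_eq_iff)
  ultimately have "(norm z)\<^sup>2 = 1" by simp
  then show ?thesis by (simp add: power2_eq_iff_nonneg[of _ 1, simplified])
qed

lemma mat_cis_in_unitary_group: "mat (cis t) \<in> unitary_group"
proof -
  have *: "conj_transpose (mat (cis t)) = mat (cis (- t))"
    by (simp add: conj_transpose_def vec_eq_iff mat_def cis_cnj)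
  show ?thesis
    unfolding unitary_group_def mem_Collect_eq *
    by (simp add: vec_eq_iff mat_mult_nth) (simp add: mat_def cis_mult)
qed

lemma unitary_group_mult:
  assumes "U \<in> unitary_group" "V \<in> unitary_group"
  shows "U ** V \<in> unitary_group"
proof -
  have *: "conj_transpose (U ** V) = conj_transpose V ** conj_transpose U"
    by (simp add: conj_transpose_def matrix_matrix_mult_def vec_eq_iff mult.commute)
  have "conj_transpose V ** conj_transpose U ** (U ** V) = mat 1"
    using assms unfolding unitary_group_def
    by (metis (mono_tags, lifting) matrix_mul_assoc matrix_mul_rid mem_Collect_eq)
  moreover have "U ** V ** (conj_transpose V ** conj_transpose U) = mat 1"
    using assms unfolding unitary_group_def
    by (metis (mono_tags, lifting) matrix_mul_assoc matrix_mul_rid mem_Collect_eq)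
  ultimately show ?thesis by (simp add: unitary_group_def *)
qed

text \<open>Column \<open>j\<close> is the image of a standard basis vector, so it has norm 1 and
  bounds each of its entries.\<close>

lemma norm_entry_unitary_le_1:
  fixes U :: "complex^'n^'n"
  assumes "U \<in> unitary_group"
  shows "norm (U $ i $ j) \<le> 1"
proof -
  have *: "(U *v axis j 1) $ i = U $ i $ j" for i
    by (simp add: matrix_vector_mult_def axis_def if_distrib[of "\<lambda>x. _ * x"] cong: if_cong)
  have "(norm (U $ i $ j))\<^sup>2 \<le> (\<Sum>i\<in>UNIV. (norm ((U *v axis j 1) $ i))\<^sup>2)"
    using member_le_sum[of i UNIV "\<lambda>i. (norm (U $ i $ j))\<^sup>2"] by (simp add: *)
  also have "\<dots> = (\<Sum>i\<in>UNIV. (norm (axis j (1::complex) $ i))\<^sup>2)"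
    by (rule sum_norm_sq_unitary[OF assms])
  also have "\<dots> = (\<Sum>i\<in>UNIV. if i = j then 1 else 0)"
    by (rule sum.cong) (auto simp: axis_def)
  finally show ?thesis by (simp add: power_le_one_iff)
qed

text \<open>Boundedness comes from the bound on entries; closedness holds because the defining
  identities are equations between continuous functions of the entries.\<close>

lemma compact_unitary_group: "compact (unitary_group :: (complex^'n^'n) set)"
proof (rule compact_eq_bounded_closed[THEN iffD2], intro conjI)
  have "norm U \<le> (\<Sum>i\<in>(UNIV::'n set). \<Sum>j\<in>(UNIV::'n set). 1)" if "U \<in> unitary_group" for U :: "complex^'n^'n"
  proof -
    have "norm U \<le> (\<Sum>i\<in>UNIV. norm (U $ i))"
      unfolding norm_vec_def by (rule L2_set_le_sum) simp
    also have "\<dots> \<le> (\<Sum>i\<in>UNIV. \<Sum>j\<in>UNIV. norm (U $ i $ j))"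
      by (rule sum_mono) (simp add: norm_vec_def L2_set_le_sum)
    also have "\<dots> \<le> (\<Sum>i\<in>(UNIV::'n set). \<Sum>j\<in>(UNIV::'n set). 1)"
      by (intro sum_mono norm_entry_unitary_le_1 that)
    finally show ?thesis .
  qed
  then show "bounded (unitary_group :: (complex^'n^'n) set)"
    by (auto simp: bounded_iff)
  have "closed {U::complex^'n^'n. (\<forall>i j. (conj_transpose U ** U) $ i $ j = mat 1 $ i $ j) \<and>
      (\<forall>i j. (U ** conj_transpose U) $ i $ j = mat 1 $ i $ j)}"
    unfolding conj_transpose_def matrix_matrix_mult_def
    by (simp, intro closed_Collect_conj closed_Collect_all closed_Collect_eq continuous_intros)
  then show "closed (unitary_group :: (complex^'n^'n) set)"
    by (simp add: unitary_group_def vec_eq_iff)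
qed

subsection \<open>Measurability of sums over eigenvalues\<close>

text \<open>The pairs list each unitary matrix with every ordering of its eigenvalues, so no
  continuous choice of eigenvalues is needed. Unimodularity bounds the vectors, and for each fixed
  \<open>w\<close> the determinant identity is a closed condition on the pair.\<close>

lemma compact_eigenvalue_vectors:
  "compact {(U::complex^'n^'n, z::complex^'n).
     U \<in> unitary_group \<and> (\<forall>i. norm (z $ i) = 1) \<and> (\<forall>w. det (mat w - U) = (\<Prod>i\<in>UNIV. w - z $ i))}"
    (is "compact ?R")
proof -
  have "bounded {z::complex^'n. \<forall>i. norm (z $ i) = 1}"
  proof (rule boundedI)
    fix z :: "complex^'n"
    assume "z \<in> {z. \<forall>i. norm (z $ i) = 1}"
    then show "norm z \<le> (\<Sum>i\<in>(UNIV::'n set). 1)"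
      using L2_set_le_sum[of UNIV "\<lambda>i. norm (z $ i)"] by (simp add: norm_vec_def)
  qed
  moreover have "closed {z::complex^'n. \<forall>i. norm (z $ i) = 1}"
    by (intro closed_Collect_all closed_Collect_eq continuous_intros)
  ultimately have "compact ((unitary_group :: (complex^'n^'n) set) \<times> {z::complex^'n. \<forall>i. norm (z $ i) = 1})"
    by (intro compact_Times compact_unitary_group) (simp add: compact_eq_bounded_closed)
  moreover have "closed {p :: (complex^'n^'n) \<times> (complex^'n).
      \<forall>w. det (mat w - fst p) = (\<Prod>i\<in>UNIV. w - snd p $ i)}"
    unfolding det_def by (intro closed_Collect_all closed_Collect_eq continuous_intros)
  ultimately have "compact (unitary_group \<times> {z::complex^'n. \<forall>i. norm (z $ i) = 1} \<inter>
      {p :: (complex^'n^'n) \<times> (complex^'n). \<forall>w. det (mat w - fst p) = (\<Prod>i\<in>UNIV. w - snd p $ i)})"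
    by (rule compact_Int_closed)
  also have "\<dots> = ?R" by auto
  finally show ?thesis .
qed

lemma ex_eigenvalue_vector:
  fixes A :: "complex^'n^'n"
  obtains z :: "complex^'n" where "eigenvalues A = image_mset (($) z) (mset_set UNIV)"
proof -
  obtain xs where xs: "mset xs = eigenvalues A"
    using ex_mset by blast
  then have len: "length xs = CARD('n)"
    using size_eigenvalues[of A] by (metis size_mset)
  obtain h where h: "bij_betw h (UNIV::'n set) {0..<CARD('n)}"
    using ex_bij_betw_finite_nat[of "UNIV::'n set"] by auto
  have "image_mset (($) (\<chi> i. xs ! h i)) (mset_set UNIV) = image_mset (\<lambda>i. xs ! h i) (mset_set UNIV)"
    by (intro image_mset_cong) simp
  also have "\<dots> = image_mset ((!) xs) (image_mset h (mset_set UNIV))"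
    by (simp add: multiset.map_comp o_def)
  also have "image_mset h (mset_set UNIV) = mset_set {0..<length xs}"
    using h len by (simp add: image_mset_mset_set bij_betw_def)
  also have "image_mset ((!) xs) (mset_set {0..<length xs}) = mset xs"
    by (metis map_nth mset_map mset_upt)
  finally show thesis using xs that by metis
qed

lemma size_filter_mset_set: "size (filter_mset P (image_mset f (mset_set A))) = card {i\<in>A. P (f i)}"
  if "finite A"
  using that by (simp add: filter_mset_image_mset o_def)

text \<open>The set is a projection of a compact set of pairs (matrix, vector of eigenvalues); this
  gives measurability of eigenvalue counts without continuity of the roots of a polynomial.\<close>

lemma compact_count_eigenvalues_ge:
  assumes "closed C"
  shows "compact {U::complex^'n^'n. U \<in> unitary_group \<and> k \<le> size {#z \<in># eigenvalues U. z \<in> C#}}"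
    (is "compact ?K")
proof -
  let ?R = "{(U::complex^'n^'n, z::complex^'n).
     U \<in> unitary_group \<and> (\<forall>i. norm (z $ i) = 1) \<and> (\<forall>w. det (mat w - U) = (\<Prod>i\<in>UNIV. w - z $ i))}"
  \<comment> \<open>At least \<open>k\<close> eigenvalues lie in \<open>C\<close> iff all entries of
    \<open>z\<close> indexed by some \<open>S\<close> with \<open>k \<le> card S\<close> do. There
    are finitely many \<open>S\<close>, and each \<open>?R \<inter> ?D S\<close> is compact, so the
    union of the projections is compact.\<close>
  let ?D = "\<lambda>S. {p :: (complex^'n^'n) \<times> (complex^'n). \<forall>i. i \<in> S \<longrightarrow> snd p $ i \<in> C}"
  have "closed (?D S)" for S
  proof (intro closed_Collect_all closed_Collect_imp open_Collect_const)
    fix i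
    have "closed ((\<lambda>p :: (complex^'n^'n) \<times> (complex^'n). snd p $ i) -` C)"
      by (intro closed_vimage assms continuous_intros)
    then show "closed {p :: (complex^'n^'n) \<times> (complex^'n). snd p $ i \<in> C}"
      by (simp add: vimage_def)
  qed
  then have "compact (\<Union>S\<in>{S. k \<le> card S}. fst ` (?R \<inter> ?D S))"
    by (intro compact_UN compact_continuous_image compact_Int_closed compact_eigenvalue_vectors
        continuous_intros) auto
  also have "(\<Union>S\<in>{S. k \<le> card S}. fst ` (?R \<inter> ?D S)) = ?K"
  proof (intro equalityI subsetI)
    fix U assume "U \<in> (\<Union>S\<in>{S. k \<le> card S}. fst ` (?R \<inter> ?D S))"
    then obtain S p where S: "k \<le> card S" and p: "p \<in> ?R" "p \<in> ?D S" "fst p = U"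
      by blast
    obtain z where "p = (U, z)"
      using p(3) by (cases p) simp
    with p have U: "U \<in> unitary_group"
      and det: "\<forall>w. det (mat w - U) = (\<Prod>i\<in>UNIV. w - z $ i)"
      and z: "\<forall>i\<in>S. z $ i \<in> C"
      by simp_all
    have "eigenvalues U = image_mset (($) z) (mset_set UNIV)"
      by (rule eigenvalues_eqI) (simp add: det prod_unfold_prod_mset multiset.map_comp o_def)
    moreover have "card S \<le> card {i. z $ i \<in> C}"
      using z by (intro card_mono) auto
    ultimately show "U \<in> ?K"
      using U S by (simp add: size_filter_mset_set)
  next
    fix U assume "U \<in> ?K"
    then have U: "U \<in> unitary_group" "k \<le> size {#z \<in># eigenvalues U. z \<in> C#}" by auto
    obtain z :: "complex^'n" where z: "eigenvalues U = image_mset (($) z) (mset_set UNIV)"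
      by (rule ex_eigenvalue_vector)
    have "norm (z $ i) = 1" for i
      using norm_eigenvalue_unitary[OF U(1), of "z $ i"] z by simp
    moreover have "det (mat w - U) = (\<Prod>i\<in>UNIV. w - z $ i)" for w
      by (simp add: det_eq_prod_eigenvalues z prod_unfold_prod_mset multiset.map_comp o_def)
    \<comment> \<open>The index set to use is that of all entries lying in \<open>C\<close>.\<close>
    ultimately have "(U, z) \<in> ?R \<inter> ?D {i. z $ i \<in> C}"
      using U(1) by simp
    moreover have "k \<le> card {i. z $ i \<in> C}"
      using U(2) by (simp add: z size_filter_mset_set)
    ultimately show "U \<in> (\<Union>S\<in>{S. k \<le> card S}. fst ` (?R \<inter> ?D S))"
      by (intro UN_I[of "{i. z $ i \<in> C}"]) (auto intro: rev_image_eqI)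
  qed
  finally show ?thesis .
qed

lemma sum_mset_indicator: "(\<Sum>z\<in>#S. indicator C z) = (of_nat (size {#z \<in># S. z \<in> C#}) :: 'a::semiring_1)"
  by (induction S) (auto simp: indicator_def)

lemma sum_mset_suminf_ennreal:
  "(\<Sum>z\<in>#S. \<Sum>i. f i z) = (\<Sum>i. \<Sum>z\<in>#S. f i z :: ennreal)"
  by (induction S) (simp_all add: suminf_add)

lemma sum_mset_SUP_ennreal:
  fixes u :: "nat \<Rightarrow> 'a \<Rightarrow> ennreal"
  assumes "incseq u"
  shows "(\<Sum>z\<in>#S. SUP i. u i z) = (SUP i. \<Sum>z\<in>#S. u i z)"
proof (induction S)
  case (add x S)
  have "incseq (\<lambda>i. \<Sum>z\<in>#S. u i z)"
    using assms by (auto simp: incseq_def le_fun_def intro!: sum_mset_mono)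
  moreover have "incseq (\<lambda>i. u i x)"
    using assms by (auto simp: incseq_def le_fun_def)
  ultimately show ?case
    using add by (simp add: ennreal_SUP_add)
qed simp

lemma measurable_sum_eigenvalues_closed:
  assumes "closed C"
  shows "(\<lambda>U::complex^'n^'n. \<Sum>z\<in>#eigenvalues U. indicator C z :: ennreal)
    \<in> borel_measurable (restrict_space borel unitary_group)"
proof -
  have "(\<lambda>U::complex^'n^'n. real (size {#z \<in># eigenvalues U. z \<in> C#}))
    \<in> borel_measurable (restrict_space borel unitary_group)"
  proof (subst borel_measurable_iff_ge, intro allI)
    fix a :: real
    \<comment> \<open>A real threshold \<open>a\<close> on an integer count amounts to
      \<open>nat \<lceil>a\<rceil>\<close>; for negative \<open>a\<close> this is 0 and the
      condition is vacuous, as it should be.\<close>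
    have "{U::complex^'n^'n. U \<in> unitary_group \<and> nat \<lceil>a\<rceil> \<le> size {#z \<in># eigenvalues U. z \<in> C#}}
      \<in> sets (restrict_space borel unitary_group)" (is "?K \<in> _")
    proof (subst sets_restrict_space_iff)
      show "unitary_group \<inter> space borel \<in> sets (borel :: (complex^'n^'n) measure)"
        by (simp add: borel_compact compact_unitary_group)
      show "?K \<subseteq> unitary_group \<and> ?K \<in> sets borel"
        using borel_compact[OF compact_count_eigenvalues_ge[OF assms]] by blast
    qed
    also have "?K = {U \<in> space (restrict_space borel unitary_group). a \<le> real (size {#z \<in># eigenvalues U. z \<in> C#})}"
      by (auto simp: space_restrict_space nat_ceiling_le_eq)
    finally show "\<dots> \<in> sets (restrict_space borel unitary_group)" .
  qed
  then show ?thesis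
    by (simp add: sum_mset_indicator ennreal_of_nat_eq_real_of_nat)
qed

text \<open>Dynkin argument: closed sets are stable under intersection and generate the Borel sets.
  Complements are handled because the total count is constantly \<open>CARD('n)\<close>, disjoint
  unions because counts add up.\<close>

lemma measurable_sum_eigenvalues_indicator:
  assumes "B \<in> sets borel"
  shows "(\<lambda>U::complex^'n^'n. \<Sum>z\<in>#eigenvalues U. indicator B z :: ennreal)
    \<in> borel_measurable (restrict_space borel unitary_group)"
proof -
  have "Int_stable (Collect (closed :: complex set \<Rightarrow> bool))"
    by (auto simp: Int_stable_def)
  moreover have "Collect closed \<subseteq> Pow (UNIV :: complex set)"
    by simp
  moreover have "B \<in> sigma_sets UNIV (Collect closed)"
    using assms by (simp add: borel_eq_closed)
  ultimately show ?thesis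
  proof (induction rule: sigma_sets_induct_disjoint)
    case (basic C)
    then show ?case by (intro measurable_sum_eigenvalues_closed) simp
  next
    case empty
    then show ?case by simp
  next
    case (compl C)
    have "(\<Sum>z\<in>#eigenvalues U. indicator C z) + (\<Sum>z\<in>#eigenvalues U. indicator (UNIV - C) z) = (of_nat CARD('n) :: ennreal)"
      for U :: "complex^'n^'n"
    proof -
      have "(\<Sum>z\<in>#eigenvalues U. indicator C z) + (\<Sum>z\<in>#eigenvalues U. indicator (UNIV - C) z)
          = (\<Sum>z\<in>#eigenvalues U. indicator C z + indicator (UNIV - C) z :: ennreal)"
        by (simp add: sum_mset.distrib)
      also have "(\<lambda>z. indicator C z + indicator (UNIV - C) z :: ennreal) = (\<lambda>_. 1)"
        by (auto simp: indicator_def)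
      finally show ?thesis by (simp add: size_eigenvalues)
    qed
    \<comment> \<open>Finiteness of the count is what permits cancellation in
      \<open>ennreal\<close>.\<close>
    moreover have "(\<Sum>z\<in>#eigenvalues U. indicator C z) \<noteq> (top::ennreal)" for U :: "complex^'n^'n"
      by (simp add: sum_mset_indicator)
    ultimately have "(\<Sum>z\<in>#eigenvalues U. indicator (UNIV - C) z)
        = (of_nat CARD('n) :: ennreal) - (\<Sum>z\<in>#eigenvalues U. indicator C z)" for U :: "complex^'n^'n"
      by (metis ennreal_add_diff_cancel_left)
    then show ?case
      using compl.IH by simp
  next
    case (union A)
    then show ?case
      by (simp add: suminf_indicator[symmetric] sum_mset_suminf_ennreal)
  qed
qed

lemma measurable_sum_eigenvalues:
  assumes "h \<in> borel_measurable borel"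
  shows "(\<lambda>U::complex^'n^'n. \<Sum>z\<in>#eigenvalues U. h z :: ennreal)
    \<in> borel_measurable (restrict_space borel unitary_group)"
  using assms
proof (induction rule: borel_measurable_induct)
  case (cong f g)
  then show ?case by simp
next
  case (set B)
  then show ?case by (rule measurable_sum_eigenvalues_indicator)
next
  case (mult u c)
  then show ?case by (simp flip: sum_mset_distrib_left)
next
  case (add u v)
  then show ?case by (simp add: sum_mset.distrib)
next
  case (seq u)
  then show ?case by (simp add: image_image sum_mset_SUP_ennreal)
qed

subsection \<open>Averaging over rotations\<close>

text \<open>The periodization as a sum in \<open>[0, \<infinity>]\<close>, without the rescaling by \<open>N / 2\<pi>\<close>.\<close>

definition orbit_sum :: "(real \<Rightarrow> ennreal) \<Rightarrow> real \<Rightarrow> ennreal" where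
  "orbit_sum F \<theta> = (\<integral>\<^sup>+j. F (\<theta> + 2 * pi * of_int j) \<partial>count_space UNIV)"

lemma borel_measurable_orbit_sum [measurable]:
  assumes [measurable]: "F \<in> borel_measurable borel"
  shows "orbit_sum F \<in> borel_measurable borel"
proof -
  interpret sigma_finite_measure "count_space (UNIV :: int set)"
    by (rule sigma_finite_measure_count_space)
  show ?thesis
    unfolding orbit_sum_def[abs_def] by measurable
qed

lemma orbit_sum_add_multiple: "orbit_sum F (\<theta> + 2 * pi * of_int k) = orbit_sum F \<theta>"
proof -
  have "bij_betw (\<lambda>j. j + k) UNIV UNIV"
    by (rule bij_betwI[where g = "\<lambda>j. j - k"]) auto
  from nn_integral_bij_count_space[OF this, of "\<lambda>j. F (\<theta> + 2 * pi * of_int j)"] show ?thesis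
    by (simp add: orbit_sum_def algebra_simps)
qed

text \<open>The two angles differ by a multiple of \<open>2 * pi\<close>, which the orbit sum does
  not see. Rotating an eigenvalue thus acts as a translation, despite the jump of
  \<open>Arg\<close>.\<close>

lemma orbit_sum_Arg_cis_mult:
  assumes "norm z = 1"
  shows "orbit_sum F (Arg (cis t * z)) = orbit_sum F (t + Arg z)"
proof -
  have "cis t * z = cis (t + Arg z)"
    using assms cis_Arg[of z] by (cases "z = 0") (auto simp: cis_mult[symmetric] sgn_eq)
  then have "cis (Arg (cis t * z)) = cis (t + Arg z)"
    by (simp add: cis_Arg)
  then have "sin (Arg (cis t * z)) = sin (t + Arg z) \<and> cos (Arg (cis t * z)) = cos (t + Arg z)"
    by (simp add: complex_eq_iff)
  then obtain k :: int where "Arg (cis t * z) = t + Arg z + 2 * pi * of_int k"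
    unfolding sin_cos_eq_iff by auto
  then show ?thesis
    by (simp only: orbit_sum_add_multiple)
qed

text \<open>The half-open intervals tile the line: \<open>x\<close> lies in exactly the one with
  index \<open>\<lfloor>(x - a) / c\<rfloor>\<close>.\<close>

lemma nn_integral_indicator_translates:
  fixes a c x :: real
  assumes "c > 0"
  shows "(\<integral>\<^sup>+j. indicator {a + c * of_int j..<a + c * of_int j + c} x \<partial>count_space (UNIV :: int set)) = 1"
proof -
  have "x \<in> {a + c * of_int j..<a + c * of_int j + c} \<longleftrightarrow> j = \<lfloor>(x - a) / c\<rfloor>" for j
    using assms by (subst eq_commute, subst floor_eq_iff) (auto simp: field_simps)
  then have "indicator {a + c * of_int j..<a + c * of_int j + c} x = (indicator {\<lfloor>(x - a) / c\<rfloor>} j :: ennreal)" for j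
    by (simp add: indicator_def)
  then show ?thesis by simp
qed

text \<open>After exchanging sum and integral, the \<open>j\<close>-th term is the integral of
  \<open>F\<close> over a window of length \<open>2 * pi\<close> starting at
  \<open>\<theta> + 2 * pi * j\<close>. These windows tile the line whatever \<open>\<theta>\<close>
  is.\<close>

lemma nn_integral_orbit_sum:
  assumes [measurable]: "F \<in> borel_measurable borel"
  shows "(\<integral>\<^sup>+t. orbit_sum F (t + \<theta>) * indicator {0..<2 * pi} t \<partial>lborel) = (\<integral>\<^sup>+x. F x \<partial>lborel)"
proof -
  have "(\<integral>\<^sup>+t. orbit_sum F (t + \<theta>) * indicator {0..<2 * pi} t \<partial>lborel)
      = (\<integral>\<^sup>+t. \<integral>\<^sup>+j. F (t + \<theta> + 2 * pi * of_int j) * indicator {0..<2 * pi} t \<partial>count_space (UNIV::int set) \<partial>lborel)"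
    by (simp add: orbit_sum_def nn_integral_multc)
  also have "\<dots> = (\<integral>\<^sup>+j. \<integral>\<^sup>+t. F (t + \<theta> + 2 * pi * of_int j) * indicator {0..<2 * pi} t \<partial>lborel \<partial>count_space (UNIV::int set))"
    by (intro nn_integral_count_space_nn_integral) auto
  also have "\<dots> = (\<integral>\<^sup>+j. \<integral>\<^sup>+x. F x * indicator {\<theta> + 2 * pi * of_int j..<\<theta> + 2 * pi * of_int j + 2 * pi} x \<partial>lborel \<partial>count_space (UNIV::int set))"
  proof (rule nn_integral_cong)
    fix j :: int
    have "(\<integral>\<^sup>+x. F x * indicator {\<theta> + 2 * pi * of_int j..<\<theta> + 2 * pi * of_int j + 2 * pi} x \<partial>lborel)
      = (\<integral>\<^sup>+t. F (\<theta> + 2 * pi * of_int j + 1 * t) * indicator {\<theta> + 2 * pi * of_int j..<\<theta> + 2 * pi * of_int j + 2 * pi} (\<theta> + 2 * pi * of_int j + 1 * t) \<partial>lborel)"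
      by (subst nn_integral_real_affine[where c = 1 and t = "\<theta> + 2 * pi * of_int j"]) auto
    also have "\<dots> = (\<integral>\<^sup>+t. F (t + \<theta> + 2 * pi * of_int j) * indicator {0..<2 * pi} t \<partial>lborel)"
      by (intro nn_integral_cong) (auto simp: indicator_def algebra_simps)
    finally show "(\<integral>\<^sup>+t. F (t + \<theta> + 2 * pi * of_int j) * indicator {0..<2 * pi} t \<partial>lborel)
      = (\<integral>\<^sup>+x. F x * indicator {\<theta> + 2 * pi * of_int j..<\<theta> + 2 * pi * of_int j + 2 * pi} x \<partial>lborel)"
      by simp
  qed
  also have "\<dots> = (\<integral>\<^sup>+x. \<integral>\<^sup>+j. F x * indicator {\<theta> + 2 * pi * of_int j..<\<theta> + 2 * pi * of_int j + 2 * pi} x \<partial>count_space (UNIV::int set) \<partial>lborel)"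
    by (intro nn_integral_count_space_nn_integral[symmetric]) auto
  also have "\<dots> = (\<integral>\<^sup>+x. F x \<partial>lborel)"
    by (simp add: nn_integral_cmult nn_integral_indicator_translates)
  finally show ?thesis .
qed

text \<open>\<open>Arg\<close> is continuous off the closed nonpositive real axis. On that axis it
  equals \<open>pi\<close>, except for the default value 0 at the origin, where both summands
  vanish.\<close>

lemma borel_measurable_Arg [measurable]: "Arg \<in> borel_measurable borel"
proof -
  have [measurable]: "(\<real>\<^sub>\<le>\<^sub>0 :: complex set) \<in> sets borel"
    by (intro borel_closed closed_nonpos_Reals_complex)
  have "(\<lambda>z. indicator (- \<real>\<^sub>\<le>\<^sub>0) z *\<^sub>R Arg z) \<in> borel_measurable borel"
    by (intro borel_measurable_continuous_on_indicator continuous_on_Arg) measurable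
  moreover have "(\<lambda>z. indicator (\<real>\<^sub>\<le>\<^sub>0 - {0::complex}) z * pi) \<in> borel_measurable borel"
    by (intro borel_measurable_times borel_measurable_indicator) auto
  ultimately have "(\<lambda>z. indicator (- \<real>\<^sub>\<le>\<^sub>0) z *\<^sub>R Arg z + indicator (\<real>\<^sub>\<le>\<^sub>0 - {0}) z * pi) \<in> borel_measurable borel"
    by (rule borel_measurable_add)
  also have "(\<lambda>z. indicator (- \<real>\<^sub>\<le>\<^sub>0) z *\<^sub>R Arg z + indicator (\<real>\<^sub>\<le>\<^sub>0 - {0}) z * pi) = Arg"
  proof
    fix z
    show "indicator (- \<real>\<^sub>\<le>\<^sub>0) z *\<^sub>R Arg z + indicator (\<real>\<^sub>\<le>\<^sub>0 - {0}) z * pi = Arg z"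
      by (cases "z = 0") (auto simp: indicator_def Arg_zero elim!: nonpos_Reals_cases)
  qed
  finally show ?thesis .
qed

lemma nn_integral_sum_mset:
  assumes "\<And>z. z \<in># S \<Longrightarrow> f z \<in> borel_measurable M"
  shows "(\<integral>\<^sup>+x. (\<Sum>z\<in>#S. f z x) \<partial>M) = (\<Sum>z\<in>#S. \<integral>\<^sup>+x. f z x \<partial>M)"
proof -
  \<comment> \<open>Measurability of the sum is carried through the induction because additivity of
    the integral requires it.\<close>
  have "(\<lambda>x. \<Sum>z\<in>#S. f z x) \<in> borel_measurable M \<and> ?thesis"
    using assms by (induction S) (auto simp: nn_integral_add)
  then show ?thesis ..
qed

section \<open>Rotation averaging under Haar measure\<close>

locale haar_unitary =
  fixes M :: "(complex^'n^'n) measure"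
  assumes haar: "haar_prob_unitary M"
begin

sublocale prob_space M
  using haar by (simp add: haar_prob_unitary_def)

lemma sets_haar: "sets M = sets (restrict_space borel unitary_group)"
  using haar by (simp add: haar_prob_unitary_def)

lemma space_haar: "space M = unitary_group"
  using sets_eq_imp_space_eq[OF sets_haar] by (simp add: space_restrict_space)

lemma measurable_haar: "measurable M N = measurable (restrict_space borel unitary_group) N"
  by (rule measurable_cong_sets[OF sets_haar refl])

text \<open>Joint measurability in \<open>t\<close> and \<open>U\<close> is needed for exchanging
  the integrals. It follows from continuity, the Borel sets of the product space being those of the
  product sigma-algebra.\<close>

lemma measurable_cis_mult: "(\<lambda>(t, U). mat (cis t) ** U) \<in> measurable (lborel \<Otimes>\<^sub>M M) M"
proof -
  have "(\<lambda>(t, U). mat (cis t) ** U) \<in> measurable (lborel \<Otimes>\<^sub>M M) (restrict_space borel unitary_group)"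
  proof (rule measurable_restrict_space2)
    show "(\<lambda>(t, U). mat (cis t) ** U) \<in> space (lborel \<Otimes>\<^sub>M M) \<rightarrow> unitary_group"
      by (auto simp: space_pair_measure space_haar intro!: unitary_group_mult mat_cis_in_unitary_group)
    have *: "mat (cis (fst p)) ** snd p = (\<chi> i j. cis (fst p) * snd p $ i $ j)"
      for p :: "real \<times> (complex^'n^'n)"
      by (simp add: vec_eq_iff mat_mult_nth)
    have "continuous_on UNIV (\<lambda>p::real \<times> (complex^'n^'n). mat (cis (fst p)) ** snd p)"
      unfolding * by (intro continuous_intros)
    then have cont: "(\<lambda>p::real \<times> (complex^'n^'n). mat (cis (fst p)) ** snd p) \<in> borel_measurable borel"
      by (rule borel_measurable_continuous_onI)
    have "(\<lambda>U. U) \<in> measurable M borel"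
      unfolding measurable_haar by (intro measurable_restrict_space1) simp
    then have "(\<lambda>p. (fst p, snd p)) \<in> measurable (lborel \<Otimes>\<^sub>M M) (borel \<Otimes>\<^sub>M (borel :: (complex^'n^'n) measure))"
      by (intro measurable_Pair measurable_compose[OF measurable_snd] measurable_compose[OF measurable_fst]) auto
    then have "(\<lambda>p. (fst p, snd p)) \<in> measurable (lborel \<Otimes>\<^sub>M M) (borel :: (real \<times> (complex^'n^'n)) measure)"
      by (simp only: borel_prod)
    from measurable_compose[OF this cont] show "(\<lambda>(t, U). mat (cis t) ** U) \<in> borel_measurable (lborel \<Otimes>\<^sub>M M)"
      by (simp add: split_beta)
  qed
  then show ?thesis
    by (subst measurable_cong_sets[OF refl sets_haar])
qed

lemma measurable_sum_orbit_sum: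
  assumes [measurable]: "F \<in> borel_measurable borel"
  shows "(\<lambda>U. \<Sum>z\<in>#eigenvalues U. orbit_sum F (Arg z)) \<in> borel_measurable M"
  unfolding measurable_haar by (intro measurable_sum_eigenvalues) measurable

text \<open>The constant \<open>2 * pi\<close> is the length of the averaging interval;
  \<open>CARD('n)\<close> is the number of eigenvalues, each of which contributes the whole integral
  of \<open>F\<close>.\<close>

lemma nn_integral_sum_orbit_sum:
  assumes F [measurable]: "F \<in> borel_measurable borel"
  shows "ennreal (2 * pi) * (\<integral>\<^sup>+U. (\<Sum>z\<in>#eigenvalues U. orbit_sum F (Arg z)) \<partial>M)
       = of_nat CARD('n) * (\<integral>\<^sup>+x. F x \<partial>lborel)"
proof -
  let ?S = "\<lambda>U::complex^'n^'n. \<Sum>z\<in>#eigenvalues U. orbit_sum F (Arg z)"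
  note S [measurable] = measurable_sum_orbit_sum[OF F]
  note cis_mult [measurable] = measurable_cis_mult
  interpret P: pair_sigma_finite lborel M ..
  \<comment> \<open>Left invariance is used only for the scalar unitary matrices
    \<open>mat (cis t)\<close>.\<close>
  have rotate: "(\<integral>\<^sup>+U. ?S U \<partial>M) = (\<integral>\<^sup>+U. ?S (mat (cis t) ** U) \<partial>M)" for t
  proof -
    have "(\<lambda>U. mat (cis t) ** U) \<in> measurable M M"
      using measurable_compose[OF measurable_Pair1' cis_mult, of t] by simp
    moreover have "distr M M (\<lambda>U. mat (cis t) ** U) = M"
      using haar mat_cis_in_unitary_group by (auto simp: haar_prob_unitary_def)
    ultimately show ?thesis
      using nn_integral_distr[of "\<lambda>U. mat (cis t) ** U" M M ?S] by simp
  qed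
  have "ennreal (2 * pi) * (\<integral>\<^sup>+U. ?S U \<partial>M) = (\<integral>\<^sup>+t. (\<integral>\<^sup>+U. ?S U \<partial>M) * indicator {0..<2 * pi} t \<partial>lborel)"
    by (subst nn_integral_cmult_indicator) (simp_all add: mult.commute)
  also have "\<dots> = (\<integral>\<^sup>+t. \<integral>\<^sup>+U. ?S (mat (cis t) ** U) * indicator {0..<2 * pi} t \<partial>M \<partial>lborel)"
  proof (rule nn_integral_cong)
    fix t :: real
    have "(\<lambda>U. ?S (mat (cis t) ** U)) \<in> borel_measurable M"
      using measurable_compose[OF measurable_compose[OF measurable_Pair1' cis_mult, of t] S] by simp
    then show "(\<integral>\<^sup>+U. ?S U \<partial>M) * indicator {0..<2 * pi} t = (\<integral>\<^sup>+U. ?S (mat (cis t) ** U) * indicator {0..<2 * pi} t \<partial>M)"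
      by (subst nn_integral_multc) (simp_all flip: rotate)
  qed
  also have "\<dots> = (\<integral>\<^sup>+U. \<integral>\<^sup>+t. ?S (mat (cis t) ** U) * indicator {0..<2 * pi} t \<partial>lborel \<partial>M)"
  proof (rule P.Fubini'[symmetric])
    have "(\<lambda>p. ?S ((\<lambda>(t, U). mat (cis t) ** U) p) * indicator {0..<2 * pi} (fst p)) \<in> borel_measurable (lborel \<Otimes>\<^sub>M M)"
      using measurable_compose[OF cis_mult S] by (intro borel_measurable_times_ennreal) measurable
    then show "(\<lambda>(t, U). ?S (mat (cis t) ** U) * indicator {0..<2 * pi} t) \<in> borel_measurable (lborel \<Otimes>\<^sub>M M)"
      by (simp add: split_beta)
  qed
  \<comment> \<open>The inner integral over \<open>t\<close> has the same value for every unitary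
    \<open>U\<close>, so a constant remains to be integrated against a probability measure.\<close>
  also have "\<dots> = (\<integral>\<^sup>+U. of_nat CARD('n) * (\<integral>\<^sup>+x. F x \<partial>lborel) \<partial>M)"
  proof (rule nn_integral_cong)
    fix U assume "U \<in> space M"
    then have norm: "norm z = 1" if "z \<in># eigenvalues U" for z
      using that by (auto simp: space_haar norm_eigenvalue_unitary)
    have "?S (mat (cis t) ** U) = (\<Sum>z\<in>#eigenvalues U. orbit_sum F (t + Arg z))" for t
    proof -
      have "?S (mat (cis t) ** U) = (\<Sum>z\<in>#eigenvalues U. orbit_sum F (Arg (cis t * z)))"
        by (simp add: eigenvalues_mat_mult multiset.map_comp o_def)
      also have "\<dots> = (\<Sum>z\<in>#eigenvalues U. orbit_sum F (t + Arg z))"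
        by (intro arg_cong[where f = sum_mset] image_mset_cong orbit_sum_Arg_cis_mult norm)
      finally show ?thesis .
    qed
    then have "?S (mat (cis t) ** U) * indicator {0..<2 * pi} t
        = (\<Sum>z\<in>#eigenvalues U. orbit_sum F (t + Arg z) * indicator {0..<2 * pi} t)" for t
      by (simp only: sum_mset_distrib_right)
    then have "(\<integral>\<^sup>+t. ?S (mat (cis t) ** U) * indicator {0..<2 * pi} t \<partial>lborel)
        = (\<Sum>z\<in>#eigenvalues U. \<integral>\<^sup>+x. F x \<partial>lborel)"
      by (simp only:) (subst nn_integral_sum_mset; simp add: nn_integral_orbit_sum)
    then show "(\<integral>\<^sup>+t. ?S (mat (cis t) ** U) * indicator {0..<2 * pi} t \<partial>lborel)
        = of_nat CARD('n) * (\<integral>\<^sup>+x. F x \<partial>lborel)"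
      by (simp add: size_eigenvalues)
  qed
  also have "\<dots> = of_nat CARD('n) * (\<integral>\<^sup>+x. F x \<partial>lborel)"
    by (simp add: emeasure_space_1)
  finally show ?thesis .
qed

end

subsection \<open>From nonnegative Borel functions to integrable functions\<close>

text \<open>Absolute summability makes the sum a Lebesgue integral for counting measure. As
  \<open>ennreal\<close> sends negative reals to 0, the two integrals are those of the positive and
  negative parts.\<close>

lemma infsum_eq_nn_integral_diff:
  fixes g :: "'a \<Rightarrow> real"
  assumes "(\<integral>\<^sup>+j. ennreal \<bar>g j\<bar> \<partial>count_space A) < \<infinity>"
  shows "infsum g A = enn2real (\<integral>\<^sup>+j. ennreal (g j) \<partial>count_space A)
    - enn2real (\<integral>\<^sup>+j. ennreal (- g j) \<partial>count_space A)"
proof -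
  have int: "integrable (count_space A) g"
    using assms by (intro integrableI_bounded) auto
  then have "infsum g A = infsetsum g A"
    by (intro infsetsum_infsum[symmetric]) (simp add: abs_summable_on_def)
  also have "\<dots> = (LINT j|count_space A. g j)"
    by (simp add: infsetsum_def)
  finally show ?thesis
    by (simp add: real_lebesgue_integral_def[OF int])
qed

text \<open>Preimages under \<open>f\<close> and \<open>g\<close> differ by a null set, and a
  complete measure measures all such modifications. This transfers measurability to a statistic
  known only almost everywhere.\<close>

lemma measurable_completion_cong_AE:
  assumes f: "f \<in> measurable (completion M) N" and eq: "AE x in completion M. f x = g x"
    and g: "\<And>x. x \<in> space M \<Longrightarrow> g x \<in> space N"
  shows "g \<in> measurable (completion M) N"
proof (rule measurableI)
  fix A assume A: "A \<in> sets N"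
  show "g -` A \<inter> space (completion M) \<in> sets (completion M)"
  proof (rule completion.in_sets_AE)
    show "AE x in completion M. x \<in> f -` A \<inter> space (completion M) \<longleftrightarrow> x \<in> g -` A \<inter> space (completion M)"
      using eq by eventually_elim auto
    show "f -` A \<inter> space (completion M) \<in> sets (completion M)"
      using f A by (rule measurable_sets)
  qed auto
qed (use g in auto)

lemma enn2real_sum_mset:
  assumes "\<And>z. z \<in># S \<Longrightarrow> f z < top"
  shows "enn2real (\<Sum>z\<in>#S. f z) = (\<Sum>z\<in>#S. enn2real (f z))"
proof -
  \<comment> \<open>Finiteness is carried along because \<open>enn2real\<close> sends \<infinity> to
    0 and is additive on finite values.\<close>
  have "(\<Sum>z\<in>#S. f z) < top \<and> ?thesis"
    using assms by (induction S) (auto simp: enn2real_plus)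
  then show ?thesis ..
qed

lemma sum_mset_subtractf:
  "(\<Sum>z\<in>#S. f z - g z) = (\<Sum>z\<in>#S. f z) - (\<Sum>z\<in>#S. g z :: 'b::ab_group_add)"
  by (induction S) simp_all

lemma sum_mset_ennreal_less_top:
  "(\<Sum>z\<in>#S. f z :: ennreal) < top \<Longrightarrow> z \<in># S \<Longrightarrow> f z < top"
  by (induction S) auto

lemma integrable_one_plus_abs_powr:
  assumes "\<epsilon> > 0"
  shows "integrable lborel (\<lambda>x::real. (1 + \<bar>x\<bar>) powr (- (1 + \<epsilon>)))"
proof -
  let ?w = "\<lambda>x::real. (1 + \<bar>x\<bar>) powr (- (1 + \<epsilon>))"
  let ?p = "\<integral>\<^sup>+x. ennreal (?w x) * indicator {0..} x \<partial>lborel"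
  have "?p = (\<integral>\<^sup>+x. ennreal ((1 + x) powr (- (1 + \<epsilon>))) * indicator {0..} x \<partial>lborel)"
    by (intro nn_integral_cong) (auto simp: indicator_def)
  \<comment> \<open>The antiderivative \<open>- ((1 + x) powr (- \<epsilon>) / \<epsilon>)\<close>
    vanishes at infinity, leaving only its value at 0.\<close>
  also have "\<dots> = ennreal (0 - (- ((1 + 0) powr (- \<epsilon>) / \<epsilon>)))"
  proof (rule nn_integral_FTC_atLeast[where F = "\<lambda>x. - ((1 + x) powr (- \<epsilon>) / \<epsilon>)"])
    fix x :: real assume "0 \<le> x"
    then show "((\<lambda>x. - ((1 + x) powr (- \<epsilon>) / \<epsilon>)) has_real_derivative (1 + x) powr (- (1 + \<epsilon>))) (at x)"
      using assms by (auto intro!: derivative_eq_intros simp: algebra_simps minus_diff_commute)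
  next
    have "((\<lambda>x. (1 + x) powr (- \<epsilon>)) \<longlongrightarrow> 0) at_top"
      using assms by (intro tendsto_neg_powr filterlim_tendsto_add_at_top[OF tendsto_const] filterlim_ident) auto
    from tendsto_minus[OF tendsto_divide[OF this tendsto_const[of \<epsilon>]]]
    show "((\<lambda>x. - ((1 + x) powr (- \<epsilon>) / \<epsilon>)) \<longlongrightarrow> 0) at_top"
      using assms by simp
  qed auto
  finally have p: "?p < \<infinity>" by simp
  \<comment> \<open>The negative half-line is reflected onto the positive one; both indicators count
    the point 0, so an inequality is used.\<close>
  have "(\<integral>\<^sup>+x. ennreal (?w x) \<partial>lborel)
      \<le> (\<integral>\<^sup>+x. ennreal (?w x) * indicator {0..} x + ennreal (?w x) * indicator {0..} (- x) \<partial>lborel)"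
    by (intro nn_integral_mono) (auto simp: indicator_def)
  also have "\<dots> = ?p + (\<integral>\<^sup>+x. ennreal (?w x) * indicator {0..} (- x) \<partial>lborel)"
    by (rule nn_integral_add) auto
  also have "(\<integral>\<^sup>+x. ennreal (?w x) * indicator {0..} (- x) \<partial>lborel) = ?p"
    by (subst nn_integral_real_affine[where c = "-1" and t = 0]) auto
  finally show ?thesis
    using p by (intro integrableI_bounded) (auto simp: le_less_trans)
qed

section \<open>Expectation of the linear statistic for Lebesgue integrable functions\<close>

context haar_unitary
begin

text \<open>The counterpart of \<open>linear_statistic\<close> with values in [0, \<infinity>]; the
  rescaling sits inside \<open>F\<close> so that the results on unscaled orbit sums apply.\<close>

definition orbit_statistic :: "(real \<Rightarrow> ennreal) \<Rightarrow> complex^'n^'n \<Rightarrow> ennreal" where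
  "orbit_statistic F U = (\<Sum>z\<in>#eigenvalues U. orbit_sum (\<lambda>x. F (real CARD('n) / (2 * pi) * x)) (Arg z))"

lemma measurable_orbit_statistic [measurable]:
  assumes [measurable]: "F \<in> borel_measurable borel"
  shows "orbit_statistic F \<in> borel_measurable M"
  unfolding orbit_statistic_def[abs_def] by (rule measurable_sum_orbit_sum) measurable

text \<open>The substitution by \<open>?c\<close> produces a factor with
  \<open>2 * pi * ?c = CARD('n)\<close>, exactly cancelling the number of eigenvalues.\<close>

lemma nn_integral_orbit_statistic:
  assumes [measurable]: "F \<in> borel_measurable borel"
  shows "(\<integral>\<^sup>+U. orbit_statistic F U \<partial>M) = (\<integral>\<^sup>+x. F x \<partial>lborel)"
proof -
  let ?c = "real CARD('n) / (2 * pi)"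
  have "ennreal (2 * pi) * (\<integral>\<^sup>+U. orbit_statistic F U \<partial>M) = of_nat CARD('n) * (\<integral>\<^sup>+x. F (?c * x) \<partial>lborel)"
    unfolding orbit_statistic_def by (rule nn_integral_sum_orbit_sum) measurable
  also have "of_nat CARD('n) = ennreal (2 * pi) * ennreal ?c"
    by (subst ennreal_mult[symmetric]) (simp_all add: ennreal_of_nat_eq_real_of_nat)
  also have "ennreal (2 * pi) * ennreal ?c * (\<integral>\<^sup>+x. F (?c * x) \<partial>lborel) = ennreal (2 * pi) * (\<integral>\<^sup>+x. F x \<partial>lborel)"
    by (subst (2) nn_integral_real_affine[where c = ?c and t = 0]) (simp_all add: mult.assoc)
  finally show ?thesis
    by (simp add: ennreal_mult_cancel_left)
qed

text \<open>Only values of \<open>f\<close> along the orbits of the eigenangles of this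
  \<open>U\<close> enter, so agreement with \<open>g\<close> there suffices. Finiteness of the
  statistic of the absolute value makes all periodizations converge absolutely.\<close>

lemma linear_statistic_eq_orbit_statistic_diff:
  assumes "orbit_statistic (\<lambda>x. ennreal \<bar>g x\<bar>) U < top"
    and eq: "\<And>z j. z \<in># eigenvalues U \<Longrightarrow>
      f (real CARD('n) / (2 * pi) * (Arg z + 2 * pi * of_int j)) = g (real CARD('n) / (2 * pi) * (Arg z + 2 * pi * of_int j))"
  shows "linear_statistic f U = enn2real (orbit_statistic (\<lambda>x. ennreal (g x)) U) - enn2real (orbit_statistic (\<lambda>x. ennreal (- g x)) U)"
proof -
  let ?o = "\<lambda>F. orbit_sum (\<lambda>x. F (real CARD('n) / (2 * pi) * x))"
  have fin: "?o (\<lambda>x. ennreal \<bar>g x\<bar>) (Arg z) < top" if "z \<in># eigenvalues U" for z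
    using sum_mset_ennreal_less_top[OF assms(1)[unfolded orbit_statistic_def] that] .
  have "?o (\<lambda>x. ennreal (g x)) t \<le> ?o (\<lambda>x. ennreal \<bar>g x\<bar>) t"
    "?o (\<lambda>x. ennreal (- g x)) t \<le> ?o (\<lambda>x. ennreal \<bar>g x\<bar>) t" for t
    unfolding orbit_sum_def by (auto intro!: nn_integral_mono ennreal_leI)
  then have fin': "?o (\<lambda>x. ennreal (g x)) (Arg z) < top" "?o (\<lambda>x. ennreal (- g x)) (Arg z) < top"
    if "z \<in># eigenvalues U" for z
    using fin[OF that] by (auto intro: le_less_trans)
  have "linear_statistic f U = (\<Sum>z\<in>#eigenvalues U. enn2real (?o (\<lambda>x. ennreal (g x)) (Arg z)) - enn2real (?o (\<lambda>x. ennreal (- g x)) (Arg z)))"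
    unfolding linear_statistic_def
  proof (intro arg_cong[where f = sum_mset] image_mset_cong)
    fix z assume z: "z \<in># eigenvalues U"
    have "periodized f CARD('n) (Arg z) = (\<Sum>\<^sub>\<infinity>j::int. g (real CARD('n) / (2 * pi) * (Arg z + 2 * pi * of_int j)))"
      unfolding periodized_def by (simp only: eq[OF z])
    also have "\<dots> = enn2real (?o (\<lambda>x. ennreal (g x)) (Arg z)) - enn2real (?o (\<lambda>x. ennreal (- g x)) (Arg z))"
      using fin[OF z] unfolding orbit_sum_def by (intro infsum_eq_nn_integral_diff) simp
    finally show "periodized f CARD('n) (Arg z) = \<dots>" .
  qed
  also have "\<dots> = enn2real (orbit_statistic (\<lambda>x. ennreal (g x)) U) - enn2real (orbit_statistic (\<lambda>x. ennreal (- g x)) U)"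
    by (simp only: orbit_statistic_def enn2real_sum_mset[OF fin'(1)] enn2real_sum_mset[OF fin'(2)] sum_mset_subtractf)
  finally show ?thesis .
qed

lemma has_bochner_integral_enn2real_orbit_statistic:
  assumes F[measurable]: "F \<in> borel_measurable borel" and "(\<integral>\<^sup>+x. F x \<partial>lborel) < top"
  shows "has_bochner_integral M (\<lambda>U. enn2real (orbit_statistic F U)) (enn2real (\<integral>\<^sup>+x. F x \<partial>lborel))"
proof (rule has_bochner_integral_nn_integral)
  \<comment> \<open>A finite mean excludes the value \<infinity> almost surely, so passing through
    \<open>enn2real\<close> does not change the integral.\<close>
  have "AE U in M. orbit_statistic F U \<noteq> \<infinity>"
    using assms by (intro nn_integral_PInf_AE) (auto simp: nn_integral_orbit_statistic)
  then have "(\<integral>\<^sup>+U. ennreal (enn2real (orbit_statistic F U)) \<partial>M) = (\<integral>\<^sup>+U. orbit_statistic F U \<partial>M)"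
    by (intro nn_integral_cong_AE) (auto elim!: eventually_mono simp: less_top)
  then show "(\<integral>\<^sup>+U. ennreal (enn2real (orbit_statistic F U)) \<partial>M) = ennreal (enn2real (\<integral>\<^sup>+x. F x \<partial>lborel))"
    using assms by (simp add: nn_integral_orbit_statistic)
qed auto

text \<open>The statistic of \<open>indicator N\<close> counts orbit points in \<open>N\<close>; its
  mean is the Lebesgue measure of \<open>N\<close>, which is 0, so the count vanishes almost
  surely.\<close>

lemma AE_eigenangles_notin_null_set:
  assumes "N \<in> null_sets lborel"
  shows "AE U in M. \<forall>z\<in>#eigenvalues U. \<forall>j::int. real CARD('n) / (2 * pi) * (Arg z + 2 * pi * of_int j) \<notin> N"
proof -
  have N [measurable]: "N \<in> sets borel"
    using assms by auto
  have "(\<integral>\<^sup>+U. orbit_statistic (indicator N) U \<partial>M) = 0"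
    using assms by (simp add: nn_integral_orbit_statistic null_sets_def)
  then have "AE U in M. orbit_statistic (indicator N) U = 0"
    by (simp add: nn_integral_0_iff_AE)
  then show ?thesis
  proof eventually_elim
    case (elim U)
    show ?case
    proof (intro ballI allI)
      fix z and j :: int assume "z \<in># eigenvalues U"
      then have "orbit_sum (\<lambda>x. indicator N (real CARD('n) / (2 * pi) * x)) (Arg z) = 0"
        using elim by (auto simp: orbit_statistic_def sum_mset_0_iff)
      then show "real CARD('n) / (2 * pi) * (Arg z + 2 * pi * of_int j) \<notin> N"
        by (auto simp: orbit_sum_def nn_integral_0_iff_AE AE_count_space indicator_def split: if_splits)
    qed
  qed
qed

lemma has_bochner_integral_linear_statistic:
  assumes f: "integrable lebesgue f"
  shows "has_bochner_integral (completion M) (linear_statistic f) (LINT x|lebesgue. f x)"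
proof -
  obtain g where g [measurable]: "g \<in> borel_measurable borel" and fg: "AE x in lborel. f x = g x"
    using completion_ex_borel_measurable_real[of f lborel] f by auto
  have fg': "AE x in lebesgue. f x = g x"
    using fg by (rule AE_completion)
  have g_int: "integrable lborel g"
    using f fg' integrable_cong_AE[of f lebesgue g] integrable_completion[of g lborel]
    by (simp add: measurable_completion borel_measurable_integrable)
  have int_eq: "(LINT x|lebesgue. f x) = (LINT x|lborel. g x)"
    using f fg' integral_cong_AE[of f lebesgue g] integral_completion[of g lborel]
    by (simp add: measurable_completion borel_measurable_integrable)
  have fin: "(\<integral>\<^sup>+x. ennreal \<bar>g x\<bar> \<partial>lborel) < top"
    using g_int by (simp add: integrable_iff_bounded)
  have "(\<integral>\<^sup>+x. ennreal (g x) \<partial>lborel) \<le> (\<integral>\<^sup>+x. ennreal \<bar>g x\<bar> \<partial>lborel)"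
    "(\<integral>\<^sup>+x. ennreal (- g x) \<partial>lborel) \<le> (\<integral>\<^sup>+x. ennreal \<bar>g x\<bar> \<partial>lborel)"
    by (auto intro!: nn_integral_mono ennreal_leI)
  then have fin': "(\<integral>\<^sup>+x. ennreal (g x) \<partial>lborel) < top" "(\<integral>\<^sup>+x. ennreal (- g x) \<partial>lborel) < top"
    using fin by (auto intro: le_less_trans)
  let ?D = "\<lambda>U. enn2real (orbit_statistic (\<lambda>x. ennreal (g x)) U) - enn2real (orbit_statistic (\<lambda>x. ennreal (- g x)) U)"
  have "has_bochner_integral M ?D
      (enn2real (\<integral>\<^sup>+x. ennreal (g x) \<partial>lborel) - enn2real (\<integral>\<^sup>+x. ennreal (- g x) \<partial>lborel))"
    using fin' by (intro has_bochner_integral_diff has_bochner_integral_enn2real_orbit_statistic) auto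
  then have D: "has_bochner_integral M ?D (LINT x|lebesgue. f x)"
    by (simp add: int_eq real_lebesgue_integral_def[OF g_int])
  \<comment> \<open>A Borel null set containing all points where \<open>f\<close> and
    \<open>g\<close> disagree, to be avoided by almost every eigenangle orbit.\<close>
  obtain N where N: "N \<in> null_sets lborel" "{x \<in> space lborel. \<not> f x = g x} \<subseteq> N"
    using fg unfolding eventually_ae_filter by blast
  have "AE U in M. orbit_statistic (\<lambda>x. ennreal \<bar>g x\<bar>) U \<noteq> \<infinity>"
    using fin by (intro nn_integral_PInf_AE) (auto simp: nn_integral_orbit_statistic)
  with AE_eigenangles_notin_null_set[OF N(1)]
  have "AE U in M. linear_statistic f U = ?D U"
  proof eventually_elim
    case (elim U)
    then show ?case
      using N(2) by (intro linear_statistic_eq_orbit_statistic_diff) (auto simp: less_top)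
  qed
  then have eq: "AE U in completion M. ?D U = linear_statistic f U"
    by (auto intro!: AE_completion elim!: eventually_mono)
  have D': "?D \<in> borel_measurable M"
    using D by (auto simp: has_bochner_integral_iff)
  then have "linear_statistic f \<in> borel_measurable (completion M)"
    by (intro measurable_completion_cong_AE[OF _ eq] measurable_completion) auto
  moreover have "has_bochner_integral (completion M) ?D (LINT x|lebesgue. f x)"
    using D D' by (simp add: has_bochner_integral_iff integrable_completion integral_completion)
  ultimately show ?thesis
    using has_bochner_integral_cong_AE[OF measurable_completion[OF D'] _ eq] by simp
qed

end

section \<open>Functions with polynomial decay and the value of the Fourier transform at 0\<close>

theorem theorem6p1:
  fixes f :: "real \<Rightarrow> real" and \<epsilon> A :: real
    and M :: "(complex^'n^'n) measure"
  assumes measurable: "f \<in> borel_measurable lebesgue"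
    and even: "\<And>x. f (- x) = f x"
    and "\<epsilon> > 0" and "A > 0"
    and decay: "\<And>x. \<bar>f x\<bar> < A * (1 + \<bar>x\<bar>) powr (- (1 + \<epsilon>))"
    and haar: "haar_prob_unitary M"
  shows "integrable (completion M) (linear_statistic f)
    \<and> complex_of_real (LINT U|completion M. linear_statistic f U) = fourier_transform f 0"
proof -
  interpret haar_unitary M
    by (rule haar_unitary.intro) (rule haar)
  have "integrable lborel (\<lambda>x. A * (1 + \<bar>x\<bar>) powr (- (1 + \<epsilon>)))"
    using integrable_one_plus_abs_powr[OF \<open>\<epsilon> > 0\<close>] by simp
  then have "integrable lebesgue (\<lambda>x. A * (1 + \<bar>x\<bar>) powr (- (1 + \<epsilon>)))"
    by (subst integrable_completion) auto
  \<comment> \<open>The decay hypothesis dominates \<open>f\<close> by an integrable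
    function.\<close>
  then have "integrable lebesgue f"
    by (rule Bochner_Integration.integrable_bound[OF _ measurable])
      (use decay in \<open>auto intro!: AE_I2 less_imp_le simp: order.strict_trans2[OF _ abs_ge_self]\<close>)
  \<comment> \<open>At frequency 0 the exponential is 1, so the transform is the integral of
    \<open>f\<close> viewed as a complex number.\<close>
  from has_bochner_integral_linear_statistic[OF this] show ?thesis
    by (simp add: has_bochner_integral_iff fourier_transform_def)
qed

end
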